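(* Let $\varepsilon>0$, let $a<b$ be real numbers, and let $\Theta$ be an ergodic stationary point process on $\mathbb{R}$ with $E|\Theta\cap[0,1]|<+\infty$. Let $A_{Q_{a,b}}=Q_{a,b}AQ_{a,b}$ and let $K$ be the (random) image of the closed unit ball of $L_2([a,b])$ under $A_{Q_{a,b}}$. Then with probability one there exists $C>0$ (possibly depending on the realization) such that the Kolmogorov widths of $K$ satisfy $$d_n(K)=O\left(\max\left\{e^{-\frac{(Cn-b)^2}{\varepsilon}},\; e^{-\frac{(Cn+a)^2}{\varepsilon}}\right\}\right),\qquad n\to\infty.$$
   Context: A point process $\Theta$ on $\mathbb{R}$ is a random locally finite set of points; it is stationary if its law is invariant under all translations of $\mathbb{R}$, and ergodic if every translation-invariant event has probability $0$ or $1$. $|\cdot|$ denotes the number of points. $p_\varepsilon(u)=\frac{1}{\sqrt{2\pi\varepsilon}}e^{-u^2/(2\varepsilon)}$ is the centred normal density with variance $\varepsilon$. $A$ is the random integral operator in $L_2(\mathbb{R})$ given by $Af(v)=\sum_{\theta\in\Theta}\left(\int_{\mathbb{R}}f(u)p_\varepsilon(u-\theta)\,du\right)p_\varepsilon(v-\theta)$. $Q_{a,b}$ is the orthogonal projection of $L_2(\mathbb{R})$ onto $L_2([a,b])$ (multiplication by the indicator of $[a,b]$), so that, for a realization of $\Theta$, $A_{Q_{a,b}}f=\sum_{\theta\in\Theta}(f,e_\theta)e_\theta$ with $e_\theta=Q_{a,b}p_\varepsilon(\cdot-\theta)$; with probability one this is a nuclear operator. For a set $K$ in a Hilbert space $H$,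 the $n$-th Kolmogorov width is $d_n(K)=\inf_{L}\sup_{x\in K}\inf_{y\in L}\|x-y\|$, where the first infimum is over linear subspaces $L\subset H$ with $\dim L\le n$. *)

theory Defs
  imports "HOL-Probability.Probability" "HOL-Library.Landau_Symbols"
begin

section \<open>The real Hilbert space of square integrable functions on the line\<close>

definition square_integrable :: "(real \<Rightarrow> real) \<Rightarrow> bool" where
  "square_integrable f \<longleftrightarrow> f \<in> borel_measurable lborel \<and> integrable lborel (\<lambda>x. (f x)\<^sup>2)"

definition l2_rel :: "(real \<Rightarrow> real) \<Rightarrow> (real \<Rightarrow> real) \<Rightarrow> bool" where
  "l2_rel f g \<longleftrightarrow> square_integrable f \<and> square_integrable g \<and> (AE x in lborel. f x = g x)"

lemma square_integrable_measurable:
  "square_integrable f \<Longrightarrow> f \<in> borel_measurable lborel"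
  by (simp add: square_integrable_def)

lemma square_integrable_zero: "square_integrable (\<lambda>_. 0)"
  by (simp add: square_integrable_def)

lemma square_integrable_mult:
  assumes "square_integrable f" "square_integrable g"
  shows "integrable lborel (\<lambda>x. f x * g x)"
proof (rule Bochner_Integration.integrable_bound)
  show "integrable lborel (\<lambda>x. (f x)\<^sup>2 + (g x)\<^sup>2)"
    using assms by (auto simp: square_integrable_def)
  show "(\<lambda>x. f x * g x) \<in> borel_measurable lborel"
    using assms by (auto simp: square_integrable_def)
  have "\<bar>s * t\<bar> \<le> s\<^sup>2 + t\<^sup>2" for s t :: real
  proof -
    have "0 \<le> (\<bar>s\<bar> - \<bar>t\<bar>)\<^sup>2" by simp
    hence "2 * (\<bar>s\<bar> * \<bar>t\<bar>) \<le> s\<^sup>2 + t\<^sup>2" by (simp add: power2_diff)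
    moreover have "0 \<le> \<bar>s\<bar> * \<bar>t\<bar>" by simp
    ultimately show ?thesis unfolding abs_mult by linarith
  qed
  thus "AE x in lborel. norm (f x * g x) \<le> norm ((f x)\<^sup>2 + (g x)\<^sup>2)"
    by simp
qed

lemma square_integrable_add:
  assumes "square_integrable f" "square_integrable g"
  shows "square_integrable (\<lambda>x. f x + g x)"
proof -
  have "integrable lborel (\<lambda>x. (f x)\<^sup>2 + (g x)\<^sup>2 + 2 * (f x * g x))"
    using assms square_integrable_mult[OF assms] by (auto simp: square_integrable_def)
  moreover have "(\<lambda>x. (f x)\<^sup>2 + (g x)\<^sup>2 + 2 * (f x * g x)) = (\<lambda>x. (f x + g x)\<^sup>2)"
    by (simp add: power2_sum algebra_simps)
  ultimately show ?thesis
    using assms by (auto simp: square_integrable_def)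
qed

lemma square_integrable_scale:
  "square_integrable f \<Longrightarrow> square_integrable (\<lambda>x. c * f x)"
  by (auto simp: square_integrable_def power_mult_distrib)

lemma square_integrable_uminus:
  "square_integrable f \<Longrightarrow> square_integrable (\<lambda>x. - f x)"
  by (auto simp: square_integrable_def)

lemma square_integrable_diff:
  "square_integrable f \<Longrightarrow> square_integrable g \<Longrightarrow> square_integrable (\<lambda>x. f x - g x)"
  using square_integrable_add[of f "\<lambda>x. - g x"] square_integrable_uminus[of g] by simp

lemma square_integrable_indicator:
  assumes "square_integrable f"
  shows "square_integrable (\<lambda>x. indicator {a..b} x * f x)"
proof -
  have "integrable lborel (\<lambda>x. indicator {a..b} x *\<^sub>R (f x)\<^sup>2)"
    using assms by (intro integrable_mult_indicator) (auto simp: square_integrable_def)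
  moreover have "(\<lambda>x. indicator {a..b} x *\<^sub>R (f x)\<^sup>2) = (\<lambda>x. (indicator {a..b} x * f x)\<^sup>2)"
    by (auto simp: fun_eq_iff indicator_def)
  ultimately show ?thesis
    using assms by (auto simp: square_integrable_def)
qed

lemma part_equivp_l2_rel: "part_equivp l2_rel"
proof (rule part_equivpI)
  show "\<exists>f. l2_rel f f"
    using square_integrable_zero by (auto simp: l2_rel_def)
  show "symp l2_rel"
    by (auto simp: symp_def l2_rel_def)
  show "transp l2_rel"
    by (auto simp: transp_def l2_rel_def)
qed

quotient_type l2 = "real \<Rightarrow> real" / partial: l2_rel
  by (rule part_equivp_l2_rel)

instantiation l2 :: real_inner
begin

lift_definition zero_l2 :: l2 is "\<lambda>_. 0"
  by (simp add: l2_rel_def square_integrable_zero)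

lift_definition plus_l2 :: "l2 \<Rightarrow> l2 \<Rightarrow> l2" is "\<lambda>f g x. f x + g x"
  by (auto simp: l2_rel_def square_integrable_add)

lift_definition minus_l2 :: "l2 \<Rightarrow> l2 \<Rightarrow> l2" is "\<lambda>f g x. f x - g x"
  by (auto simp: l2_rel_def square_integrable_diff)

lift_definition uminus_l2 :: "l2 \<Rightarrow> l2" is "\<lambda>f x. - f x"
  by (auto simp: l2_rel_def square_integrable_uminus)

lift_definition scaleR_l2 :: "real \<Rightarrow> l2 \<Rightarrow> l2" is "\<lambda>c f x. c * f x"
  by (auto simp: l2_rel_def square_integrable_scale)

lift_definition inner_l2 :: "l2 \<Rightarrow> l2 \<Rightarrow> real" is "\<lambda>f g. \<integral>x. f x * g x \<partial>lborel"
  by (rule integral_cong_AE) (auto simp: l2_rel_def square_integrable_def)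

definition norm_l2 :: "l2 \<Rightarrow> real" where "norm_l2 f = sqrt (inner f f)"
definition sgn_l2 :: "l2 \<Rightarrow> l2" where "sgn_l2 f = inverse (norm f) *\<^sub>R f"
definition dist_l2 :: "l2 \<Rightarrow> l2 \<Rightarrow> real" where "dist_l2 f g = norm (f - g)"
definition uniformity_l2 :: "(l2 \<times> l2) filter" where
  "uniformity_l2 = (INF e\<in>{0 <..}. principal {(x, y). dist x y < e})"
definition open_l2 :: "l2 set \<Rightarrow> bool" where
  "open_l2 U \<longleftrightarrow> (\<forall>x\<in>U. eventually (\<lambda>(x', y). x' = x \<longrightarrow> y \<in> U) uniformity)"

instance
proof
  fix f g h :: l2 and r s :: real
  show "f + g + h = f + (g + h)"
    by transfer (auto simp: l2_rel_def square_integrable_add algebra_simps)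
  show "f + g = g + f"
    by transfer (auto simp: l2_rel_def square_integrable_add algebra_simps)
  show "0 + f = f"
    by transfer (auto simp: l2_rel_def)
  show "- f + f = 0"
    by transfer (auto simp: l2_rel_def square_integrable_zero)
  show "f - g = f + - g"
    by transfer (auto simp: l2_rel_def square_integrable_diff)
  show "r *\<^sub>R (f + g) = r *\<^sub>R f + r *\<^sub>R g"
    by transfer (auto simp: l2_rel_def square_integrable_add square_integrable_scale
        ring_distribs)
  show "(r + s) *\<^sub>R f = r *\<^sub>R f + s *\<^sub>R f"
    by transfer (auto simp: l2_rel_def square_integrable_add square_integrable_scale
        ring_distribs)
  show "r *\<^sub>R s *\<^sub>R f = (r * s) *\<^sub>R f"
    by transfer (auto simp: l2_rel_def square_integrable_scale mult.assoc)
  show "1 *\<^sub>R f = f"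
    by transfer (auto simp: l2_rel_def)
  show "dist f g = norm (f - g)" by (rule dist_l2_def)
  show "sgn f = inverse (norm f) *\<^sub>R f" by (rule sgn_l2_def)
  show "(uniformity :: (l2 \<times> l2) filter) = (INF e\<in>{0 <..}. principal {(x, y). dist x y < e})"
    by (rule uniformity_l2_def)
  show "open U \<longleftrightarrow> (\<forall>x\<in>U. eventually (\<lambda>(x', y). x' = x \<longrightarrow> y \<in> U) uniformity)" for U :: "l2 set"
    by (rule open_l2_def)
  show "inner f g = inner g f"
    by transfer (simp add: mult.commute)
  show "inner (f + g) h = inner f h + inner g h"
    by transfer (simp add: l2_rel_def ring_distribs square_integrable_mult)
  show "inner (r *\<^sub>R f) g = r * inner f g"
    by transfer (simp add: mult.assoc)
  show "0 \<le> inner f f"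
    by transfer simp
  show "inner f f = 0 \<longleftrightarrow> f = 0"
  proof transfer
    fix f assume "l2_rel f f"
    hence f: "square_integrable f" by (simp add: l2_rel_def)
    have "(\<integral>x. f x * f x \<partial>lborel) = 0 \<longleftrightarrow> (AE x in lborel. f x * f x = 0)"
      by (rule integral_nonneg_eq_0_iff_AE) (use square_integrable_mult[OF f f] in auto)
    thus "(\<integral>x. f x * f x \<partial>lborel) = 0 \<longleftrightarrow> l2_rel f (\<lambda>_. 0)"
      using f by (simp add: l2_rel_def square_integrable_zero)
  qed
  show "norm f = sqrt (inner f f)" by (rule norm_l2_def)
qed

end

section \<open>Kolmogorov widths\<close>

text \<open>Finite-dimensionality is required separately, because \<^const>\<open>dim\<close> is \<open>0\<close> on
  infinite-dimensional subspaces. The value is meaningful for bounded \<open>K\<close>; otherwise the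
  real-valued supremum is unspecified.\<close>

definition kolmogorov_width :: "nat \<Rightarrow> 'a::real_normed_vector set \<Rightarrow> real" where
  "kolmogorov_width n K =
     (INF L\<in>{L. subspace L \<and> (\<exists>B. finite B \<and> L = span B) \<and> dim L \<le> n}.
        SUP x\<in>K. INF y\<in>L. norm (x - y))"

section \<open>The operators\<close>

abbreviation gauss :: "real \<Rightarrow> real \<Rightarrow> real" where
  "gauss \<epsilon> \<equiv> normal_density 0 (sqrt \<epsilon>)"

lemma gauss_eq: "\<epsilon> > 0 \<Longrightarrow> gauss \<epsilon> u = 1 / sqrt (2 * pi * \<epsilon>) * exp (- u\<^sup>2 / (2 * \<epsilon>))"
  by (simp add: normal_density_def)

definition A_fun :: "real \<Rightarrow> real set \<Rightarrow> (real \<Rightarrow> real) \<Rightarrow> real \<Rightarrow> real" where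
  "A_fun \<epsilon> S f v = (\<Sum>\<^sub>\<infinity>\<theta>\<in>S. (\<integral>u. f u * gauss \<epsilon> (u - \<theta>) \<partial>lborel) * gauss \<epsilon> (v - \<theta>))"

lemma A_fun_cong:
  assumes "l2_rel f g" shows "A_fun \<epsilon> S f = A_fun \<epsilon> S g"
proof -
  have "(\<integral>u. f u * gauss \<epsilon> (u - \<theta>) \<partial>lborel) = (\<integral>u. g u * gauss \<epsilon> (u - \<theta>) \<partial>lborel)" for \<theta>
    by (rule integral_cong_AE) (use assms in \<open>auto simp: l2_rel_def square_integrable_def\<close>)
  thus ?thesis by (simp add: A_fun_def fun_eq_iff)
qed

text \<open>For a given realization \<open>S\<close> the operator need not be defined on all of \<open>L\<^sub>2(\<real>)\<close>: the
  value is \<open>0\<close> where the defining function is not square integrable.\<close>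

lift_definition A_op :: "real \<Rightarrow> real set \<Rightarrow> l2 \<Rightarrow> l2" is
  "\<lambda>\<epsilon> S f. if square_integrable (A_fun \<epsilon> S f) then A_fun \<epsilon> S f else (\<lambda>_. 0)"
  by (auto simp: A_fun_cong) (auto simp: l2_rel_def square_integrable_zero)

lift_definition Q :: "real \<Rightarrow> real \<Rightarrow> l2 \<Rightarrow> l2" is "\<lambda>a b f x. indicator {a..b} x * f x"
  by (auto simp: l2_rel_def square_integrable_indicator)

definition A_Q :: "real \<Rightarrow> real set \<Rightarrow> real \<Rightarrow> real \<Rightarrow> l2 \<Rightarrow> l2" where
  "A_Q \<epsilon> S a b = Q a b \<circ> A_op \<epsilon> S \<circ> Q a b"

text \<open>\<open>L\<^sub>2([a,b])\<close> is the closed subspace \<open>range (Q a b)\<close> of \<open>L\<^sub>2(\<real>)\<close>.\<close>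

definition K_set :: "real \<Rightarrow> real set \<Rightarrow> real \<Rightarrow> real \<Rightarrow> l2 set" where
  "K_set \<epsilon> S a b = A_Q \<epsilon> S a b ` {f \<in> range (Q a b). norm f \<le> 1}"

section \<open>Point processes on the line\<close>

definition locally_finite_sets :: "real set set" where
  "locally_finite_sets = {S. \<forall>B. bounded B \<longrightarrow> finite (S \<inter> B)}"

definition config_space :: "real set measure" where
  "config_space = sigma locally_finite_sets
     {{S \<in> locally_finite_sets. card (S \<inter> B) = k} | B k. B \<in> sets borel \<and> bounded B}"

abbreviation translate :: "real \<Rightarrow> real set \<Rightarrow> real set" where
  "translate t S \<equiv> (\<lambda>x. t + x) ` S"

definition point_process :: "'w measure \<Rightarrow> ('w \<Rightarrow> real set) \<Rightarrow> bool" where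
  "point_process M \<Theta> \<longleftrightarrow> prob_space M \<and> \<Theta> \<in> measurable M config_space"

definition stationary :: "'w measure \<Rightarrow> ('w \<Rightarrow> real set) \<Rightarrow> bool" where
  "stationary M \<Theta> \<longleftrightarrow>
     (\<forall>t. distr M config_space (\<lambda>\<omega>. translate t (\<Theta> \<omega>)) = distr M config_space \<Theta>)"

definition ergodic :: "'w measure \<Rightarrow> ('w \<Rightarrow> real set) \<Rightarrow> bool" where
  "ergodic M \<Theta> \<longleftrightarrow>
     (\<forall>E\<in>sets config_space.
        (\<forall>t. \<forall>S\<in>locally_finite_sets. translate t S \<in> E \<longleftrightarrow> S \<in> E) \<longrightarrow>
        measure (distr M config_space \<Theta>) E \<in> {0, 1})"

lemma space_config_space: "space config_space = locally_finite_sets"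
  unfolding config_space_def by (rule space_measure_of) auto

lemma translate_locally_finite:
  assumes "S \<in> locally_finite_sets" shows "translate t S \<in> locally_finite_sets"
  unfolding locally_finite_sets_def
proof (intro CollectI allI impI)
  fix B :: "real set" assume "bounded B"
  hence "finite (S \<inter> translate (- t) B)"
    using assms bounded_translation[of B "- t"] unfolding locally_finite_sets_def by blast
  moreover have "translate t S \<inter> B \<subseteq> translate t (S \<inter> translate (- t) B)"
    by force
  ultimately show "finite (translate t S \<inter> B)"
    by (meson finite_imageI finite_subset)
qed

text \<open>Hence the image measures in \<^const>\<open>stationary\<close> are the genuine laws.\<close>

lemma measurable_translate: "translate t \<in> measurable config_space config_space"
proof -
  let ?N = "{{S \<in> locally_finite_sets. card (S \<inter> B) = k} | B k. B \<in> sets borel \<and> bounded B}"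
  have "translate t \<in> measurable config_space (sigma locally_finite_sets ?N)"
  proof (rule measurable_measure_of)
    show "?N \<subseteq> Pow locally_finite_sets" by auto
    show "translate t \<in> space config_space \<rightarrow> locally_finite_sets"
      using translate_locally_finite by (auto simp: space_config_space)
    fix E assume "E \<in> ?N"
    then obtain B k where B: "B \<in> sets borel" "bounded B"
      and E: "E = {S \<in> locally_finite_sets. card (S \<inter> B) = k}" by auto
    have "translate (- t) B = (\<lambda>x. t + x) -` B \<inter> space borel"
      by (force simp: image_iff)
    hence B': "translate (- t) B \<in> sets borel"
      using measurable_sets[of "\<lambda>x. t + x" borel borel B] B(1) by simp
    have "translate t S \<inter> B = translate t (S \<inter> translate (- t) B)" for S
      by force
    hence "card (translate t S \<inter> B) = card (S \<inter> translate (- t) B)" for S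
      by (simp add: card_image)
    hence "translate t -` E \<inter> space config_space =
        {S \<in> locally_finite_sets. card (S \<inter> translate (- t) B) = k}"
      using translate_locally_finite by (auto simp: E space_config_space)
    moreover have "\<dots> \<in> ?N"
      using B' bounded_translation[OF B(2), of "- t"] by blast
    moreover have "?N \<subseteq> sets config_space"
      unfolding config_space_def by (subst sets_measure_of) auto
    ultimately show "translate t -` E \<inter> space config_space \<in> sets config_space"
      by (metis (no_types, lifting) subsetD)
  qed
  thus ?thesis by (simp add: config_space_def)
qed

end

(*
  The numbers of points of \<Theta> in successive unit intervals form a stationary integrable sequence, so by
  the maximal ergodic theorem almost every realization S satisfies |S \<inter> [-n, n]| = O(n). The
  coefficients (f, e_\<theta>) are O(exp(-\<beta> \<theta>^2)) uniformly over the unit ball, so K lies within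
  O(exp(-\<beta> r^2 / 2)) of the span of the e_\<theta> with |\<theta>| \<le> r, whose dimension is O(r). Choosing r
  proportional to n bounds the width by O(exp(-\<delta> n^2)) for some \<delta> > 0, and a small C turns this
  into the asserted rate.
*)
theory Submission
  imports Defs "HOL-Real_Asymp.Real_Asymp"
begin

section \<open>The maximal ergodic theorem\<close>

text \<open>This is the largest of the Birkhoff sums of lengths 0 to \<open>n\<close>, the empty sum
  included. The recursion encodes that a sum of length k + 1 at \<open>x\<close> is
  \<open>f x\<close> plus the sum of length k at \<open>T x\<close>, which is the comparison made in
  Garsia's argument.\<close>

primrec maximal_sum :: "('a \<Rightarrow> 'a) \<Rightarrow> ('a \<Rightarrow> real) \<Rightarrow> nat \<Rightarrow> 'a \<Rightarrow> real" where
  "maximal_sum T f 0 x = 0"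
| "maximal_sum T f (Suc n) x = max 0 (f x + maximal_sum T f n (T x))"

lemma maximal_sum_nonneg: "0 \<le> maximal_sum T f n x"
  by (cases n) auto

lemma maximal_sum_le_Suc: "maximal_sum T f n x \<le> maximal_sum T f (Suc n) x"
proof (induction n arbitrary: x)
  case (Suc n)
  from Suc[of "T x"] show ?case
    by (auto simp: max_def)
qed (simp add: max_def)

lemma birkhoff_sum_le_maximal_sum:
  "(\<Sum>i<n. f ((T ^^ i) x)) \<le> maximal_sum T f n x"
proof (induction n arbitrary: x)
  case (Suc n)
  have "(\<Sum>i<Suc n. f ((T ^^ i) x)) = f x + (\<Sum>i<n. f ((T ^^ i) (T x)))"
    by (simp only: sum.lessThan_Suc_shift funpow_Suc_right) simp
  with Suc[of "T x"] show ?case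
    by (auto simp: max_def)
qed simp

text \<open>Applied later to the law of the point process with \<open>T\<close> the translation by 1
  or by -1; stationarity then supplies \<open>T_distr\<close>.\<close>

locale measure_preserving = prob_space P for P :: "'a measure" +
  fixes T :: "'a \<Rightarrow> 'a"
  assumes T_measurable [measurable]: "T \<in> measurable P P"
    and T_distr: "distr P P T = P"
begin

lemma integrable_comp:
  fixes f :: "'a \<Rightarrow> real"
  assumes "integrable P f" shows "integrable P (\<lambda>x. f (T x))"
  by (rule integrable_distr[OF T_measurable]) (simp add: T_distr assms)

lemma integral_comp:
  fixes f :: "'a \<Rightarrow> real"
  assumes "integrable P f" shows "(\<integral>x. f (T x) \<partial>P) = (\<integral>x. f x \<partial>P)"
  using integral_distr[OF T_measurable, of f] assms by (simp add: T_distr)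

lemma integrable_maximal_sum:
  assumes "integrable P f" shows "integrable P (maximal_sum T f n)"
proof (induction n)
  case (Suc n)
  have "maximal_sum T f (Suc n) = (\<lambda>x. max 0 (f x + maximal_sum T f n (T x)))"
    by (simp add: fun_eq_iff)
  with integrable_comp[OF Suc] assms show ?case
    by simp
qed (simp cong: integrable_cong)

text \<open>Garsia's argument: where the maximum is positive, it exceeds its shift by at most \<open>f\<close>.\<close>

lemma maximal_ergodic:
  assumes f: "integrable P f"
  shows "0 \<le> (\<integral>x. indicator {x. 0 < maximal_sum T f n x} x * f x \<partial>P)"
proof (cases n)
  case (Suc k)
  let ?m = "maximal_sum T f n"
  let ?g = "\<lambda>x. indicator {x. 0 < ?m x} x * f x"
  have m: "integrable P ?m" by (rule integrable_maximal_sum[OF f])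
  have meas [measurable]: "?m \<in> borel_measurable P" "f \<in> borel_measurable P"
    using m f by auto
  have g: "integrable P ?g"
    by (rule Bochner_Integration.integrable_bound[OF f]) (auto simp: indicator_def)
  have "?m x \<le> ?g x + ?m (T x)" for x
    using maximal_sum_nonneg[of T f n "T x"] maximal_sum_le_Suc[of T f k "T x"]
    by (auto simp: Suc indicator_def max_def split: if_splits)
  hence "(\<integral>x. ?m x \<partial>P) \<le> (\<integral>x. ?g x + ?m (T x) \<partial>P)"
    by (intro integral_mono m Bochner_Integration.integrable_add g integrable_comp)
  \<comment> \<open>Invariance gives \<open>?m\<close> and its shift the same finite integral, so
    the two cancel and leave the claim.\<close>
  also have "\<dots> = (\<integral>x. ?g x \<partial>P) + (\<integral>x. ?m x \<partial>P)"
    using g integrable_comp[OF m] by (simp add: integral_comp[OF m])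
  finally show ?thesis by simp
qed simp

text \<open>The maximal ergodic theorem for \<open>f - c\<close> makes \<open>c\<close> times the
  probability of \<open>A n\<close> at most the integral of \<open>f\<close> over
  \<open>A n\<close>, and nonnegativity of \<open>f\<close> enlarges this to the full integral. The
  events \<open>A n\<close> increase, so the bound passes to their union.\<close>

lemma prob_maximal_sum_pos:
  fixes f :: "'a \<Rightarrow> real"
  assumes f: "integrable P f" and nonneg: "\<And>x. 0 \<le> f x" and "0 < c"
  shows "prob {x\<in>space P. \<exists>n. 0 < maximal_sum T (\<lambda>x. f x - c) n x} \<le> (\<integral>x. f x \<partial>P) / c"
proof -
  let ?m = "maximal_sum T (\<lambda>x. f x - c)"
  define A where "A n = {x\<in>space P. 0 < ?m n x}" for n
  have fc: "integrable P (\<lambda>x. f x - c)"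
    using f by simp
  have [measurable]: "?m n \<in> borel_measurable P" for n
    using integrable_maximal_sum[OF fc] by auto
  have A [measurable]: "A n \<in> sets P" for n
    unfolding A_def by measurable
  have "prob (A n) \<le> (\<integral>x. f x \<partial>P) / c" for n
  proof -
    have "0 \<le> (\<integral>x. indicator {x. 0 < ?m n x} x * (f x - c) \<partial>P)"
      by (rule maximal_ergodic[OF fc])
    also have "\<dots> \<le> (\<integral>x. f x - c * indicator (A n) x \<partial>P)"
    proof (rule integral_mono)
      show "integrable P (\<lambda>x. indicator {x. 0 < ?m n x} x * (f x - c))"
        by (rule Bochner_Integration.integrable_bound[OF fc]) (use f in \<open>auto simp: indicator_def\<close>)
      show "integrable P (\<lambda>x. f x - c * indicator (A n) x)"
        using f A by (simp add: less_top[symmetric])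
    qed (use nonneg in \<open>auto simp: indicator_def A_def\<close>)
    also have "\<dots> = (\<integral>x. f x \<partial>P) - c * prob (A n)"
      using f A by (simp add: less_top[symmetric])
    finally show ?thesis
      using \<open>0 < c\<close> by (simp add: field_simps)
  qed
  moreover have "(\<lambda>n. prob (A n)) \<longlonglongrightarrow> prob (\<Union>n. A n)"
  proof (rule finite_Lim_measure_incseq)
    show "incseq A"
      using maximal_sum_le_Suc[of T "\<lambda>x. f x - c"]
      by (intro incseq_SucI) (auto simp: A_def intro: less_le_trans simp del: maximal_sum.simps)
  qed auto
  moreover have "(\<Union>n. A n) = {x\<in>space P. \<exists>n. 0 < ?m n x}"
    by (auto simp: A_def)
  ultimately show ?thesis
    by (auto intro: LIMSEQ_le_const2)
qed

text \<open>A linear upper bound follows from the maximal inequality alone, without convergence of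
  the averages: the probability that some average exceeds \<open>c\<close> is at most the mean of
  \<open>f\<close> divided by \<open>c\<close>, and this tends to 0. Integer levels keep the
  intersection of the events \<open>B c\<close> countable.\<close>

lemma AE_birkhoff_sums_linear:
  fixes f :: "'a \<Rightarrow> real"
  assumes f: "integrable P f" and nonneg: "\<And>x. 0 \<le> f x"
  shows "AE x in P. \<exists>c::nat. \<forall>n. (\<Sum>i<n. f ((T ^^ i) x)) \<le> c * n"
proof -
  define B where "B c = {x\<in>space P. \<exists>n. 0 < maximal_sum T (\<lambda>x. f x - real c) n x}" for c :: nat
  have [measurable]: "maximal_sum T (\<lambda>x. f x - real c) n \<in> borel_measurable P" for c n
    using integrable_maximal_sum[of "\<lambda>x. f x - real c"] f by auto
  have [measurable]: "B c \<in> sets P" for c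
    unfolding B_def by measurable
  \<comment> \<open>The maximal inequality asks for a positive level, hence
    \<open>Suc c\<close>.\<close>
  have "prob (\<Inter>c. B c) \<le> (\<integral>x. f x \<partial>P) / Suc c" for c
  proof -
    have "prob (\<Inter>c. B c) \<le> prob (B (Suc c))"
      by (rule finite_measure_mono) auto
    also have "\<dots> \<le> (\<integral>x. f x \<partial>P) / Suc c"
      unfolding B_def by (rule prob_maximal_sum_pos[OF f nonneg]) auto
    finally show ?thesis .
  qed
  moreover have "(\<lambda>c. (\<integral>x. f x \<partial>P) / Suc c) \<longlonglongrightarrow> 0"
    by (rule LIMSEQ_Suc[OF lim_const_over_n])
  ultimately have "prob (\<Inter>c. B c) \<le> 0"
    by (intro LIMSEQ_le_const) auto
  hence "(\<Inter>c. B c) \<in> null_sets P"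
    by (auto simp: null_sets_def emeasure_eq_measure measure_le_0_iff)
  hence "AE x in P. x \<notin> (\<Inter>c. B c)"
    by (rule AE_not_in)
  with AE_space show ?thesis
  proof eventually_elim
    case (elim x)
    then obtain c where c: "\<And>n. maximal_sum T (\<lambda>x. f x - real c) n x \<le> 0"
      by (auto simp: B_def not_less)
    have "(\<Sum>i<n. f ((T ^^ i) x)) \<le> c * n" for n
    proof -
      have "(\<Sum>i<n. f ((T ^^ i) x) - real c) \<le> 0"
        using birkhoff_sum_le_maximal_sum[of "\<lambda>x. f x - real c" T x n] c[of n] by linarith
      thus ?thesis by (simp add: sum_subtractf mult.commute)
    qed
    thus ?case by blast
  qed
qed

end

section \<open>Linear growth of the number of points\<close>

lemma finite_locally_finite_Int:
  "S \<in> locally_finite_sets \<Longrightarrow> bounded B \<Longrightarrow> finite (S \<inter> B)"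
  by (simp add: locally_finite_sets_def)

text \<open>The generators of \<open>config_space\<close> are the events that a count takes a given
  value, and any set of counts is a countable union of single values.\<close>

lemma measurable_count:
  assumes "B \<in> sets borel" "bounded B"
  shows "(\<lambda>S. real (card (S \<inter> B))) \<in> borel_measurable config_space"
proof -
  have "(\<lambda>S. card (S \<inter> B)) \<in> measurable config_space (count_space UNIV)"
  proof (rule measurableI)
    fix A :: "nat set"
    have "{S \<in> locally_finite_sets. card (S \<inter> B) = k} \<in> sets config_space" for k
      unfolding config_space_def by (subst sets_measure_of) (use assms in blast)+
    hence "(\<Union>k\<in>A. {S \<in> locally_finite_sets. card (S \<inter> B) = k}) \<in> sets config_space"
      by (intro sets.countable_UN') auto
    also have "(\<Union>k\<in>A. {S \<in> locally_finite_sets. card (S \<inter> B) = k}) =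
        (\<lambda>S. card (S \<inter> B)) -` A \<inter> space config_space"
      by (auto simp: space_config_space)
    finally show "(\<lambda>S. card (S \<inter> B)) -` A \<inter> space config_space \<in> sets config_space" .
  qed simp
  thus ?thesis by simp
qed

lemma translate_translate: "translate s (translate t S) = translate (s + t) S"
  by (simp add: image_image add.assoc)

lemma translate_funpow: "(translate t ^^ n) S = translate (real n * t) S"
  by (induction n) (auto simp: translate_translate distrib_right)

lemma card_translate_Int: "card (translate t S \<inter> {x..y}) = card (S \<inter> {x - t..y - t})"
proof -
  have "translate t S \<inter> {x..y} = translate t (S \<inter> {x - t..y - t})"
    by force
  thus ?thesis by (simp add: card_image)
qed

text \<open>Unit intervals on both sides of 0 cover the large interval. Birkhoff sums run in one
  direction only, so two translations occur: \<open>translate 1\<close> brings the intervals on the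
  left to \<open>{0..1}\<close>, \<open>translate (-1)\<close> those on the right. Shared endpoints
  may be counted twice, which only enlarges the bound.\<close>

lemma card_Int_Icc_le_sum:
  assumes "S \<in> locally_finite_sets"
  shows "card (S \<inter> {- real n..real n}) \<le>
    (\<Sum>i<Suc n. card ((translate 1 ^^ i) S \<inter> {0..1})) + (\<Sum>i<Suc n. card ((translate (-1) ^^ i) S \<inter> {0..1}))"
proof -
  let ?L = "\<lambda>i. S \<inter> {- real i..1 - real i}" and ?R = "\<lambda>i. S \<inter> {real i..1 + real i}"
  have cover: "S \<inter> {- real n..real n} \<subseteq> (\<Union>i<Suc n. ?L i) \<union> (\<Union>i<Suc n. ?R i)"
  proof
    fix x assume x: "x \<in> S \<inter> {- real n..real n}"
    show "x \<in> (\<Union>i<Suc n. ?L i) \<union> (\<Union>i<Suc n. ?R i)"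
    proof (cases "x \<ge> 0")
      case True
      hence "nat \<lfloor>x\<rfloor> < Suc n" "x \<in> ?R (nat \<lfloor>x\<rfloor>)"
        using x by (auto simp: less_Suc_eq_le nat_le_iff floor_le_iff) linarith
      thus ?thesis by blast
    next
      case False
      hence "nat \<lceil>-x\<rceil> < Suc n" "x \<in> ?L (nat \<lceil>-x\<rceil>)"
        using x by (auto simp: less_Suc_eq_le nat_le_iff ceiling_le_iff) linarith+
      thus ?thesis by blast
    qed
  qed
  have fin: "finite (?L i)" "finite (?R i)" for i
    using assms by (auto intro!: finite_locally_finite_Int)
  have "card (S \<inter> {- real n..real n}) \<le> card ((\<Union>i<Suc n. ?L i) \<union> (\<Union>i<Suc n. ?R i))"
    using fin by (intro card_mono[OF _ cover] finite_UnI finite_UN_I finite_lessThan)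
  also have "\<dots> \<le> (\<Sum>i<Suc n. card (?L i)) + (\<Sum>i<Suc n. card (?R i))"
    using fin by (intro order_trans[OF card_Un_le] add_mono card_UN_le) auto
  finally show ?thesis
    by (simp only: translate_funpow card_translate_Int) (simp add: algebra_simps)
qed

text \<open>The observable is the number of points in \<open>{0..1}\<close>, integrable by the
  first-moment hypothesis; its Birkhoff sums under the two translations control both half-lines. The
  factor \<open>Suc n\<close> is the number of unit intervals used on each side.\<close>

lemma AE_linear_count:
  assumes pp: "point_process M \<Theta>" and st: "stationary M \<Theta>"
    and int: "(\<integral>\<^sup>+\<omega>. of_nat (card (\<Theta> \<omega> \<inter> {0..1})) \<partial>M) < \<infinity>"
  shows "AE \<omega> in M. \<exists>c::nat. \<forall>n. card (\<Theta> \<omega> \<inter> {- real n..real n}) \<le> c * Suc n"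
proof -
  \<comment> \<open>Translations act on configurations and not on the sample space, so the ergodic
    argument runs on the law of \<open>\<Theta>\<close> and is pulled back at the end.\<close>
  define P where "P = distr M config_space \<Theta>"
  define f :: "real set \<Rightarrow> real" where "f S = real (card (S \<inter> {0..1}))" for S
  have \<Theta> [measurable]: "\<Theta> \<in> measurable M config_space" and "prob_space M"
    using pp by (auto simp: point_process_def)
  then interpret M: prob_space M by simp
  interpret P: prob_space P
    unfolding P_def by (rule M.prob_space_distr[OF \<Theta>])
  have mp: "measure_preserving P (translate t)" for t
  proof
    show "translate t \<in> measurable P P"
      by (simp add: P_def measurable_translate)
    show "distr P P (translate t) = P"
      using st distr_distr[OF measurable_translate[of t] \<Theta>]
      by (simp add: P_def stationary_def comp_def cong: distr_cong)
  qed
  have f [measurable]: "f \<in> borel_measurable config_space"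
    unfolding f_def by (rule measurable_count) auto
  have "integrable M (\<lambda>\<omega>. f (\<Theta> \<omega>))"
  proof (rule integrableI_nonneg)
    show "(\<integral>\<^sup>+\<omega>. ennreal (f (\<Theta> \<omega>)) \<partial>M) < \<infinity>"
      using int by (simp add: f_def ennreal_of_nat_eq_real_of_nat)
  qed (auto simp: f_def[symmetric], simp add: f_def)
  hence int_f: "integrable P f"
    unfolding P_def by (simp add: integrable_distr_eq)
  have "AE S in P. (\<exists>c::nat. \<forall>n. (\<Sum>i<n. f ((translate t ^^ i) S)) \<le> c * n)" for t
    by (rule measure_preserving.AE_birkhoff_sums_linear[OF mp int_f]) (simp add: f_def)
  from this[of 1] this[of "-1"] have "AE S in P. (\<exists>c::nat. \<forall>n. card (S \<inter> {- real n..real n}) \<le> c * Suc n)"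
    using AE_space
  proof eventually_elim
    case (elim S)
    then obtain c d :: nat where
      c: "\<And>n. (\<Sum>i<n. f ((translate 1 ^^ i) S)) \<le> c * n" and
      d: "\<And>n. (\<Sum>i<n. f ((translate (-1) ^^ i) S)) \<le> d * n"
      by blast
    have S: "S \<in> locally_finite_sets"
      using elim by (simp add: P_def space_config_space)
    have "card (S \<inter> {- real n..real n}) \<le> (c + d) * Suc n" for n
    proof -
      have "real (card (S \<inter> {- real n..real n})) \<le>
          (\<Sum>i<Suc n. f ((translate 1 ^^ i) S)) + (\<Sum>i<Suc n. f ((translate (-1) ^^ i) S))"
        using of_nat_mono[OF card_Int_Icc_le_sum[OF S, of n], where 'a = real]
        by (simp only: f_def of_nat_add of_nat_sum)
      also have "\<dots> \<le> real ((c + d) * Suc n)"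
        using add_mono[OF c[of "Suc n"] d[of "Suc n"]] by (simp only: distrib_right of_nat_add)
      finally show ?thesis by (simp only: of_nat_le_iff)
    qed
    thus ?case by blast
  qed
  thus ?thesis
    unfolding P_def by (rule AE_distrD[OF \<Theta>])
qed

section \<open>Gaussian sums over a configuration\<close>

text \<open>The points are grouped into shells by the rounded-up value of their modulus. Shell
  \<open>k\<close> has at most \<open>c * Suc k\<close> points, and the Gaussian factor beats this
  linear growth. The terms are nonnegative, so a uniform bound on finite partial sums is
  enough.\<close>

lemma summable_on_gauss_linear_count:
  fixes S :: "real set"
  assumes S: "S \<in> locally_finite_sets"
    and count: "\<And>n. card (S \<inter> {- real n..real n}) \<le> c * Suc n" and "0 < \<beta>"
  shows "(\<lambda>\<theta>. exp (- (\<beta> * \<theta>\<^sup>2))) summable_on S"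
proof (rule nonneg_bdd_above_summable_on)
  \<comment> \<open>A bound for shell \<open>k\<close>. Half of the exponent and the factor
    \<open>exp \<beta>\<close> pay for the rounding: a point in the shell has modulus at least k -
    1, so the square of k is at most twice that of the point plus 2.\<close>
  define h where "h k = real (c * Suc k) * (exp \<beta> * exp (- (\<beta> * (real k)\<^sup>2 / 2)))" for k
  have "h \<in> O(\<lambda>k. inverse (real k ^ 2))"
    unfolding h_def using \<open>0 < \<beta>\<close> by real_asymp
  hence summable: "summable h"
    by (rule summable_comparison_test_bigo[rotated]) (simp add: inverse_power_summable)
  have h_nonneg: "0 \<le> h k" for k
    by (simp add: h_def)
  show "bdd_above (sum (\<lambda>\<theta>. exp (- (\<beta> * \<theta>\<^sup>2))) ` {F. F \<subseteq> S \<and> finite F})"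
  proof (rule bdd_aboveI2)
    fix F assume "F \<in> {F. F \<subseteq> S \<and> finite F}"
    hence F: "F \<subseteq> S" "finite F" by auto
    let ?r = "\<lambda>\<theta>. nat \<lceil>\<bar>\<theta>\<bar>\<rceil>"
    have shell: "(\<Sum>\<theta> | \<theta> \<in> F \<and> ?r \<theta> = k. exp (- (\<beta> * \<theta>\<^sup>2))) \<le> h k" for k
    proof -
      have "exp (- (\<beta> * \<theta>\<^sup>2)) \<le> exp \<beta> * exp (- (\<beta> * (real k)\<^sup>2 / 2))" if "?r \<theta> = k" for \<theta>
      proof -
        have "real k \<le> \<bar>\<theta>\<bar> + 1"
          using that by linarith
        hence "(real k)\<^sup>2 \<le> (\<bar>\<theta>\<bar> + 1)\<^sup>2"
          by (intro power_mono) auto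
        also have "\<dots> \<le> 2 * \<theta>\<^sup>2 + 2"
          using sum_squares_bound[of "\<bar>\<theta>\<bar>" 1] by (simp add: power2_sum)
        finally have "\<beta> * (real k)\<^sup>2 \<le> \<beta> * (2 * \<theta>\<^sup>2 + 2)"
          using \<open>0 < \<beta>\<close> by simp
        thus ?thesis
          by (simp add: exp_add[symmetric] algebra_simps)
      qed
      hence "(\<Sum>\<theta> | \<theta> \<in> F \<and> ?r \<theta> = k. exp (- (\<beta> * \<theta>\<^sup>2))) \<le>
          real (card {\<theta> \<in> F. ?r \<theta> = k}) * (exp \<beta> * exp (- (\<beta> * (real k)\<^sup>2 / 2)))"
        by (intro sum_bounded_above) auto
      also have "card {\<theta> \<in> F. ?r \<theta> = k} \<le> card (S \<inter> {- real k..real k})"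
      proof (rule card_mono)
        show "finite (S \<inter> {- real k..real k})"
          using S by (rule finite_locally_finite_Int) auto
        show "{\<theta> \<in> F. ?r \<theta> = k} \<subseteq> S \<inter> {- real k..real k}"
          using F by (auto; linarith)
      qed
      also note count
      finally show ?thesis
        by (simp add: h_def mult_right_mono)
    qed
    obtain N where "?r ` F \<subseteq> {..<N}"
      using F finite_nat_iff_bounded[of "?r ` F"] by auto
    hence "(\<Sum>\<theta>\<in>F. exp (- (\<beta> * \<theta>\<^sup>2))) = (\<Sum>k<N. \<Sum>\<theta> | \<theta> \<in> F \<and> ?r \<theta> = k. exp (- (\<beta> * \<theta>\<^sup>2)))"
      using F by (subst sum.group) auto
    also have "\<dots> \<le> sum h {..<N}"
      by (intro sum_mono shell)
    also have "\<dots> \<le> suminf h"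
      using summable h_nonneg by (intro sum_le_suminf) auto
    finally show "(\<Sum>\<theta>\<in>F. exp (- (\<beta> * \<theta>\<^sup>2))) \<le> suminf h" .
  qed
qed simp

text \<open>The exponent is split into halves: outside the interval one half is at least its value
  at \<open>r\<close> and gives the small factor, while the other half keeps the sum finite.\<close>

lemma infsum_gauss_tail_le:
  fixes S :: "real set"
  assumes summable: "(\<lambda>\<theta>. exp (- (\<beta> / 2 * \<theta>\<^sup>2))) summable_on S" and "0 < \<beta>" "0 \<le> r"
  shows "(\<Sum>\<^sub>\<infinity>\<theta>\<in>S - {- r..r}. exp (- (\<beta> * \<theta>\<^sup>2))) \<le>
    exp (- (\<beta> / 2 * r\<^sup>2)) * (\<Sum>\<^sub>\<infinity>\<theta>\<in>S. exp (- (\<beta> / 2 * \<theta>\<^sup>2)))"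
proof -
  let ?g = "\<lambda>\<theta>. exp (- (\<beta> / 2 * r\<^sup>2)) * exp (- (\<beta> / 2 * \<theta>\<^sup>2))"
  have g: "?g summable_on S"
    by (rule summable_on_cmult_right[OF summable])
  have le: "exp (- (\<beta> * \<theta>\<^sup>2)) \<le> ?g \<theta>" if "\<theta> \<notin> {- r..r}" for \<theta>
  proof -
    have "r\<^sup>2 \<le> \<theta>\<^sup>2"
      using that \<open>0 \<le> r\<close> by (intro abs_le_square_iff[THEN iffD1]) auto
    hence "\<beta> * r\<^sup>2 \<le> \<beta> * \<theta>\<^sup>2"
      using \<open>0 < \<beta>\<close> by simp
    thus ?thesis
      by (simp add: exp_add[symmetric])
  qed
  have g': "?g summable_on S - {- r..r}"
    by (rule summable_on_subset_banach[OF g]) auto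
  have "(\<lambda>\<theta>. exp (- (\<beta> * \<theta>\<^sup>2))) summable_on S - {- r..r}"
    by (rule summable_on_comparison_test[OF g']) (use le in auto)
  hence "(\<Sum>\<^sub>\<infinity>\<theta>\<in>S - {- r..r}. exp (- (\<beta> * \<theta>\<^sup>2))) \<le> infsum ?g (S - {- r..r})"
    using g' le by (intro infsum_mono) auto
  also have "\<dots> \<le> infsum ?g S"
    using g g' by (intro infsum_mono2) auto
  also have "\<dots> = exp (- (\<beta> / 2 * r\<^sup>2)) * (\<Sum>\<^sub>\<infinity>\<theta>\<in>S. exp (- (\<beta> / 2 * \<theta>\<^sup>2)))"
    by (rule infsum_cmult_right')
  finally show ?thesis .
qed

section \<open>Approximation by truncated sums\<close>

lemma abs_l2_cases:
  obtains g where "square_integrable g" "f = abs_l2 g"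
  \<comment> \<open>The representative is related to itself, and for the partial relation
    \<open>l2_rel\<close> this contains its square integrability.\<close>
  using Quotient_rep_reflp[OF Quotient_l2, of f] Quotient_abs_rep[OF Quotient_l2, of f]
  by (metis l2_rel_def)

lemma l2_rel_refl: "square_integrable f \<Longrightarrow> l2_rel f f"
  by (simp add: l2_rel_def)

lemma norm_abs_l2:
  assumes "square_integrable f" shows "norm (abs_l2 f) = sqrt (\<integral>x. (f x)\<^sup>2 \<partial>lborel)"
  using assms by (simp add: norm_l2_def inner_l2.abs_eq l2_rel_refl power2_eq_square)

lemma square_integrable_sum:
  "(\<And>i. i \<in> I \<Longrightarrow> square_integrable (f i)) \<Longrightarrow> square_integrable (\<lambda>x. \<Sum>i\<in>I. f i x)"
  by (induction I rule: infinite_finite_induct)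
    (auto simp: square_integrable_zero square_integrable_add)

lemma sum_abs_l2:
  "(\<And>i. i \<in> I \<Longrightarrow> square_integrable (f i)) \<Longrightarrow>
    (\<Sum>i\<in>I. abs_l2 (f i)) = abs_l2 (\<lambda>x. \<Sum>i\<in>I. f i x)"
  by (induction I rule: infinite_finite_induct)
    (auto simp: zero_l2_def plus_l2.abs_eq l2_rel_refl square_integrable_sum)

section \<open>Bounds for truncated Gaussians and for the coefficients of the operator\<close>

lemma integrable_indicator_Icc: "integrable lborel (indicator {a..b} :: real \<Rightarrow> real)"
  by (rule integrable_real_indicator) (auto simp: emeasure_lborel_Icc_eq)

lemma normal_density_le: "normal_density \<mu> \<sigma> x \<le> 1 / sqrt (2 * pi * \<sigma>\<^sup>2)"
proof -
  have "exp (- (x - \<mu>)\<^sup>2 / (2 * \<sigma>\<^sup>2)) \<le> 1" by simp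
  hence "1 / sqrt (2 * pi * \<sigma>\<^sup>2) * exp (- (x - \<mu>)\<^sup>2 / (2 * \<sigma>\<^sup>2)) \<le> 1 / sqrt (2 * pi * \<sigma>\<^sup>2) * 1"
    by (intro mult_left_mono) auto
  thus ?thesis by (simp add: normal_density_def)
qed

text \<open>The density is bounded by its peak value and the interval has finite length. The
  statement covers every real \<epsilon> because \<open>cut_gauss\<close> is lifted as a total
  function.\<close>

lemma square_integrable_cut_gauss:
  "square_integrable (\<lambda>x. indicator {a..b} x * gauss \<epsilon> (x - \<theta>))"
proof -
  let ?c = "1 / sqrt (2 * pi * (sqrt \<epsilon>)\<^sup>2)"
  have "integrable lborel (\<lambda>x. (indicator {a..b} x * gauss \<epsilon> (x - \<theta>))\<^sup>2)"
  proof (rule Bochner_Integration.integrable_bound)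
    show "integrable lborel (\<lambda>x::real. indicator {a..b} x * ?c\<^sup>2)"
      by (intro integrable_mult_left integrable_indicator_Icc)
    have "(indicator {a..b} x * gauss \<epsilon> (x - \<theta>))\<^sup>2 \<le> indicator {a..b} x * ?c\<^sup>2" for x
      using normal_density_le[of 0 "sqrt \<epsilon>" "x - \<theta>"]
      by (auto simp: indicator_def simp del: real_sqrt_pow2_iff intro!: power_mono)
    thus "AE x in lborel. norm ((indicator {a..b} x * gauss \<epsilon> (x - \<theta>))\<^sup>2) \<le>
        norm (indicator {a..b} x * ?c\<^sup>2)"
      by (auto simp: indicator_def)
  qed measurable
  thus ?thesis
    by (simp add: square_integrable_def)
qed

text \<open>The vectors e_\<theta>, projections of the shifted densities to [a,b]; finitely many of
  them span each approximating subspace.\<close>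

lift_definition cut_gauss :: "real \<Rightarrow> real \<Rightarrow> real \<Rightarrow> real \<Rightarrow> l2" is
  "\<lambda>\<epsilon> a b \<theta> x. indicator {a..b} x * gauss \<epsilon> (x - \<theta>)"
  by (intro l2_rel_refl square_integrable_cut_gauss)

text \<open>The exponent comes from \<open>\<theta>\<^sup>2 \<le> 2 (u - \<theta>)\<^sup>2 + 2 u\<^sup>2\<close>.\<close>

lemma gauss_shift_le:
  assumes "0 < \<epsilon>" "a \<le> u" "u \<le> b"
  shows "gauss \<epsilon> (u - \<theta>) \<le>
    1 / sqrt (2 * pi * \<epsilon>) * exp ((a\<^sup>2 + b\<^sup>2) / (2 * \<epsilon>)) * exp (- (1 / (4 * \<epsilon>) * \<theta>\<^sup>2))"
proof -
  have "u\<^sup>2 \<le> a\<^sup>2 + b\<^sup>2"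
  proof (cases "u \<ge> 0")
    case True
    hence "u\<^sup>2 \<le> b\<^sup>2" using assms by (intro power_mono) auto
    thus ?thesis using zero_le_power2[of a] by linarith
  next
    case False
    hence "(- u)\<^sup>2 \<le> (- a)\<^sup>2" using assms by (intro power_mono) auto
    thus ?thesis using zero_le_power2[of b] by (simp only: power2_minus)
  qed
  moreover have "\<theta>\<^sup>2 \<le> 2 * (u - \<theta>)\<^sup>2 + 2 * u\<^sup>2"
    using zero_le_power2[of "\<theta> - 2 * u"] by (simp add: power2_eq_square algebra_simps)
  ultimately have "\<theta>\<^sup>2 \<le> 2 * (u - \<theta>)\<^sup>2 + 2 * (a\<^sup>2 + b\<^sup>2)"
    by (elim order_trans) simp
  hence "\<epsilon> * (2 * \<theta>\<^sup>2) \<le> \<epsilon> * (4 * a\<^sup>2 + 4 * b\<^sup>2 + 4 * (u - \<theta>)\<^sup>2)"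
    using \<open>0 < \<epsilon>\<close> by (intro mult_left_mono) auto
  hence "- (u - \<theta>)\<^sup>2 / (2 * \<epsilon>) \<le> (a\<^sup>2 + b\<^sup>2) / (2 * \<epsilon>) + - (1 / (4 * \<epsilon>) * \<theta>\<^sup>2)"
    using \<open>0 < \<epsilon>\<close> by (simp add: field_simps)
  hence "exp (- (u - \<theta>)\<^sup>2 / (2 * \<epsilon>)) \<le> exp ((a\<^sup>2 + b\<^sup>2) / (2 * \<epsilon>)) * exp (- (1 / (4 * \<epsilon>) * \<theta>\<^sup>2))"
    by (simp only: exp_add[symmetric] exp_le_cancel_iff)
  thus ?thesis
    using \<open>0 < \<epsilon>\<close> by (simp only: gauss_eq mult.assoc) (intro mult_left_mono, auto)
qed

text \<open>On [a,b] the Gaussian is at most \<open>M\<close>, and there the modulus of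
  \<open>g\<close> is at most its square plus 1. Integrating this elementary inequality takes the
  place of Cauchy-Schwarz and produces the factor \<open>1 + (b - a)\<close>.\<close>

lemma gauss_coefficient_le:
  assumes "0 < \<epsilon>" "a \<le> b" and g: "square_integrable g" and g1: "(\<integral>x. (g x)\<^sup>2 \<partial>lborel) \<le> 1"
    and supp: "\<And>x. x \<notin> {a..b} \<Longrightarrow> g x = 0"
  shows "\<bar>\<integral>u. g u * gauss \<epsilon> (u - \<theta>) \<partial>lborel\<bar> \<le>
    (1 + (b - a)) * (1 / sqrt (2 * pi * \<epsilon>) * exp ((a\<^sup>2 + b\<^sup>2) / (2 * \<epsilon>))) * exp (- (1 / (4 * \<epsilon>) * \<theta>\<^sup>2))"
proof -
  define M where
    "M = 1 / sqrt (2 * pi * \<epsilon>) * exp ((a\<^sup>2 + b\<^sup>2) / (2 * \<epsilon>)) * exp (- (1 / (4 * \<epsilon>) * \<theta>\<^sup>2))"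
  have M: "gauss \<epsilon> (u - \<theta>) \<le> M" if "u \<in> {a..b}" for u
    unfolding M_def using that \<open>0 < \<epsilon>\<close> by (intro gauss_shift_le) auto
  have "0 \<le> M"
    using \<open>0 < \<epsilon>\<close> by (simp add: M_def)
  have ind: "integrable lborel (indicator {a..b} :: real \<Rightarrow> real)"
    by (rule integrable_indicator_Icc)
  have sq: "integrable lborel (\<lambda>x. (g x)\<^sup>2)" and meas [measurable]: "g \<in> borel_measurable borel"
    using g by (auto simp: square_integrable_def)
  have "\<bar>\<integral>u. g u * gauss \<epsilon> (u - \<theta>) \<partial>lborel\<bar> \<le> (\<integral>u. ((g u)\<^sup>2 + indicator {a..b} u) * M \<partial>lborel)"
  proof -
    have bound: "\<bar>g u * gauss \<epsilon> (u - \<theta>)\<bar> \<le> ((g u)\<^sup>2 + indicator {a..b} u) * M" for u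
    proof (cases "u \<in> {a..b}")
      case True
      have "\<bar>g u\<bar> \<le> (g u)\<^sup>2 + 1"
        using sum_squares_bound[of "\<bar>g u\<bar>" 1] by simp
      thus ?thesis
        unfolding abs_mult using True M[OF True] by (intro mult_mono) auto
    qed (simp add: supp)
    have dom: "integrable lborel (\<lambda>u. ((g u)\<^sup>2 + indicator {a..b} u) * M)"
      using sq ind by (intro integrable_mult_left Bochner_Integration.integrable_add)
    have "integrable lborel (\<lambda>u. g u * gauss \<epsilon> (u - \<theta>))"
      by (rule Bochner_Integration.integrable_bound[OF dom])
        (use bound in \<open>auto intro: order_trans[OF _ abs_ge_self]\<close>)
    thus ?thesis
      using bound dom unfolding real_norm_def[symmetric]
      by (intro Bochner_Integration.integral_norm_bound_integral)
  qed
  also have "\<dots> = ((\<integral>u. (g u)\<^sup>2 \<partial>lborel) + (b - a)) * M"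
    using sq ind \<open>a \<le> b\<close> by simp
  also have "\<dots> \<le> (1 + (b - a)) * M"
    using g1 \<open>0 \<le> M\<close> by (intro mult_right_mono) auto
  finally show ?thesis
    by (simp add: M_def mult.assoc)
qed

section \<open>Truncation error, uniform over the image of the unit ball\<close>

lemma norm_infsum_diff_sum_le:
  fixes f :: "'a \<Rightarrow> 'b::banach"
  assumes "(\<lambda>x. norm (f x)) summable_on S" "finite F" "F \<subseteq> S"
  shows "norm (infsum f S - sum f F) \<le> (\<Sum>\<^sub>\<infinity>x\<in>S - F. norm (f x))"
proof -
  have "(\<lambda>x. norm (f x)) summable_on S - F"
    by (rule summable_on_subset_banach[OF assms(1)]) auto
  moreover have "infsum f S - sum f F = infsum f (S - F)"
    using assms abs_summable_summable[OF assms(1)] by (simp add: infsum_Diff)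
  ultimately show ?thesis
    by (simp add: norm_infsum_bound)
qed

text \<open>The series is cut down to \<open>F\<close> pointwise in \<open>v\<close>. Each omitted
  term is small uniformly in \<open>v\<close>, and a uniform error on [a,b] costs only
  \<open>sqrt (b - a)\<close> in norm. The bound is the same for all \<open>x\<close>, as a width
  estimate requires.\<close>

lemma A_Q_approx:
  assumes \<epsilon>: "0 < \<epsilon>" and ab: "a \<le> b"
    and summable: "(\<lambda>\<theta>. exp (- (1 / (4 * \<epsilon>) * \<theta>\<^sup>2))) summable_on S"
    and F: "finite F" "F \<subseteq> S" and x: "x \<in> K_set \<epsilon> S a b"
  shows "\<exists>c. norm (x - (\<Sum>\<theta>\<in>F. c \<theta> *\<^sub>R cut_gauss \<epsilon> a b \<theta>)) \<le>
    sqrt (b - a) * ((1 + (b - a)) * (1 / sqrt (2 * pi * \<epsilon>) * exp ((a\<^sup>2 + b\<^sup>2) / (2 * \<epsilon>))) / sqrt (2 * pi * \<epsilon>)) *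
      (\<Sum>\<^sub>\<infinity>\<theta>\<in>S - F. exp (- (1 / (4 * \<epsilon>) * \<theta>\<^sup>2)))"
proof -
  \<comment> \<open>\<open>D\<close> controls the coefficients; \<open>E\<close> controls whole
    terms of the series and is \<open>D\<close> times the peak value of the Gaussian.\<close>
  define D where "D = (1 + (b - a)) * (1 / sqrt (2 * pi * \<epsilon>) * exp ((a\<^sup>2 + b\<^sup>2) / (2 * \<epsilon>)))"
  define E where "E = D / sqrt (2 * pi * \<epsilon>)"
  define \<phi> where "\<phi> \<theta> = exp (- (1 / (4 * \<epsilon>) * \<theta>\<^sup>2))" for \<theta>
  have "0 \<le> D" "0 \<le> E"
    using \<epsilon> ab by (auto simp: D_def E_def)
  obtain f where f: "norm f \<le> 1" "f \<in> range (Q a b)" "x = A_Q \<epsilon> S a b f"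
    using x by (auto simp: K_set_def)
  then obtain f0 where f0: "square_integrable f0" "f = Q a b (abs_l2 f0)"
    by (metis abs_l2_cases imageE)
  define g where "g = (\<lambda>u. indicator {a..b} u * f0 u)"
  have g: "square_integrable g"
    unfolding g_def by (rule square_integrable_indicator[OF f0(1)])
  have fg: "f = abs_l2 g"
    using f0 by (simp add: Q.abs_eq l2_rel_refl g_def)
  \<comment> \<open>The ball lies in the range of the projection, so the inner \<open>Q a b\<close>
    acts as the identity on \<open>f\<close>.\<close>
  have Qf: "Q a b f = f"
    by (simp add: fg Q.abs_eq l2_rel_refl g) (simp add: g_def mult.assoc[symmetric] flip: indicator_inter_arith)
  have g1: "(\<integral>x. (g x)\<^sup>2 \<partial>lborel) \<le> 1"
    using f(1) by (simp add: fg norm_abs_l2[OF g])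
  show ?thesis
  proof (cases "square_integrable (A_fun \<epsilon> S g)")
    \<comment> \<open>Here \<open>A_op\<close> takes its default value 0, hence \<open>x\<close> is
      0 and zero coefficients suffice.\<close>
    case False
    hence "A_op \<epsilon> S f = 0"
      by (simp add: fg A_op.abs_eq l2_rel_refl g zero_l2_def)
    hence "x = 0"
      by (simp add: f A_Q_def Qf zero_l2_def Q.abs_eq l2_rel_refl square_integrable_zero)
    hence "norm (x - (\<Sum>\<theta>\<in>F. 0 *\<^sub>R cut_gauss \<epsilon> a b \<theta>)) = 0"
      by simp
    thus ?thesis
      using \<open>0 \<le> E\<close> ab
      by (intro exI[of _ "\<lambda>_. 0"]) (auto simp: E_def D_def intro!: mult_nonneg_nonneg infsum_nonneg)
  next
    case True
    \<comment> \<open>Since \<open>g\<close> vanishes off [a,b], this is the inner product (f,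
      e_\<theta>).\<close>
    define c where "c \<theta> = (\<integral>u. g u * gauss \<epsilon> (u - \<theta>) \<partial>lborel)" for \<theta>
    have c: "\<bar>c \<theta>\<bar> \<le> D * \<phi> \<theta>" for \<theta>
      unfolding c_def D_def \<phi>_def
      by (rule gauss_coefficient_le[OF \<epsilon> ab g g1]) (simp add: g_def)
    have term_le: "\<bar>c \<theta> * gauss \<epsilon> (v - \<theta>)\<bar> \<le> E * \<phi> \<theta>" for \<theta> v
    proof -
      have "\<bar>c \<theta> * gauss \<epsilon> (v - \<theta>)\<bar> \<le> (D * \<phi> \<theta>) * (1 / sqrt (2 * pi * (sqrt \<epsilon>)\<^sup>2))"
        unfolding abs_mult using c[of \<theta>] normal_density_le[of 0 "sqrt \<epsilon>" "v - \<theta>"]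
        by (intro mult_mono) auto
      thus ?thesis
        using \<epsilon> by (simp add: E_def)
    qed
    define T where "T = E * (\<Sum>\<^sub>\<infinity>\<theta>\<in>S - F. \<phi> \<theta>)"
    have "0 \<le> T"
      using \<open>0 \<le> E\<close> by (auto simp: T_def \<phi>_def intro!: mult_nonneg_nonneg infsum_nonneg)
    have E\<phi>: "(\<lambda>\<theta>. E * \<phi> \<theta>) summable_on S"
      unfolding \<phi>_def by (rule summable_on_cmult_right[OF summable])
    have tail: "\<bar>A_fun \<epsilon> S g v - (\<Sum>\<theta>\<in>F. c \<theta> * gauss \<epsilon> (v - \<theta>))\<bar> \<le> T" for v
    proof -
      have abs_summable: "(\<lambda>\<theta>. norm (c \<theta> * gauss \<epsilon> (v - \<theta>))) summable_on S"
        by (rule summable_on_comparison_test[OF E\<phi>]) (use term_le in auto)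
      have "\<bar>A_fun \<epsilon> S g v - (\<Sum>\<theta>\<in>F. c \<theta> * gauss \<epsilon> (v - \<theta>))\<bar> \<le>
          (\<Sum>\<^sub>\<infinity>\<theta>\<in>S - F. norm (c \<theta> * gauss \<epsilon> (v - \<theta>)))"
        using norm_infsum_diff_sum_le[OF abs_summable F] by (simp add: A_fun_def c_def)
      also have "\<dots> \<le> (\<Sum>\<^sub>\<infinity>\<theta>\<in>S - F. E * \<phi> \<theta>)"
        by (intro infsum_mono summable_on_subset_banach[OF abs_summable]
            summable_on_subset_banach[OF E\<phi>]) (use term_le in auto)
      also have "\<dots> = T"
        unfolding T_def by (rule infsum_cmult_right')
      finally show ?thesis .
    qed
    let ?e = "\<lambda>\<theta> u. c \<theta> * (indicator {a..b} u * gauss \<epsilon> (u - \<theta>))"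
    \<comment> \<open>A representative of the difference to be estimated; it vanishes off [a,b] and
      has modulus at most \<open>T\<close> there.\<close>
    let ?d = "\<lambda>u. indicator {a..b} u * A_fun \<epsilon> S g u - (\<Sum>\<theta>\<in>F. ?e \<theta> u)"
    have e: "square_integrable (?e \<theta>)" for \<theta>
      by (intro square_integrable_scale square_integrable_cut_gauss)
    have d: "square_integrable ?d"
      by (intro square_integrable_diff square_integrable_indicator square_integrable_sum e True)
    have "x = abs_l2 (\<lambda>u. indicator {a..b} u * A_fun \<epsilon> S g u)"
      using True by (simp add: f(3) A_Q_def Qf)
        (simp add: fg A_op.abs_eq Q.abs_eq l2_rel_refl g)
    moreover have "(\<Sum>\<theta>\<in>F. c \<theta> *\<^sub>R cut_gauss \<epsilon> a b \<theta>) = abs_l2 (\<lambda>u. \<Sum>\<theta>\<in>F. ?e \<theta> u)"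
      by (subst sum_abs_l2[symmetric, OF e])
        (simp add: cut_gauss_def scaleR_l2.abs_eq l2_rel_refl square_integrable_cut_gauss)
    ultimately have "x - (\<Sum>\<theta>\<in>F. c \<theta> *\<^sub>R cut_gauss \<epsilon> a b \<theta>) = abs_l2 ?d"
      by (simp add: minus_l2.abs_eq l2_rel_refl square_integrable_indicator True
          square_integrable_sum e)
    hence "norm (x - (\<Sum>\<theta>\<in>F. c \<theta> *\<^sub>R cut_gauss \<epsilon> a b \<theta>)) = sqrt (\<integral>u. (?d u)\<^sup>2 \<partial>lborel)"
      by (simp add: norm_abs_l2[OF d])
    also have "\<dots> \<le> sqrt (\<integral>u. indicator {a..b} u * T\<^sup>2 \<partial>lborel)"
    proof (intro real_sqrt_le_mono integral_mono)
      show "integrable lborel (\<lambda>u. (?d u)\<^sup>2)"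
        using d by (simp add: square_integrable_def)
      fix u
      have "?d u = indicator {a..b} u * (A_fun \<epsilon> S g u - (\<Sum>\<theta>\<in>F. c \<theta> * gauss \<epsilon> (u - \<theta>)))"
        by (auto simp: indicator_def)
      moreover have "(A_fun \<epsilon> S g u - (\<Sum>\<theta>\<in>F. c \<theta> * gauss \<epsilon> (u - \<theta>)))\<^sup>2 \<le> T\<^sup>2"
        using tail[of u] by (rule power2_le_iff_abs_le[THEN iffD2, OF \<open>0 \<le> T\<close>])
      ultimately show "(?d u)\<^sup>2 \<le> indicator {a..b} u * T\<^sup>2"
        by (simp add: indicator_def)
    qed (intro integrable_mult_left integrable_indicator_Icc)
    also have "\<dots> = sqrt (b - a) * T"
      using ab \<open>0 \<le> T\<close> by (simp add: real_sqrt_mult)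
    finally show ?thesis
      by (auto simp: T_def E_def D_def \<phi>_def mult.assoc)
  qed
qed

section \<open>Bounds for the widths\<close>

lemma INF_norm_diff:
  assumes "y \<in> L" shows "(INF y\<in>L. norm (x - y)) \<le> norm (x - y)" "0 \<le> (INF y\<in>L. norm (x - y))"
proof -
  show "(INF y\<in>L. norm (x - y)) \<le> norm (x - y)"
    by (rule cINF_lower[OF _ assms]) (auto intro: bdd_belowI2[of _ 0])
  show "0 \<le> (INF y\<in>L. norm (x - y))"
    using assms by (intro cINF_greatest) auto
qed

text \<open>Boundedness of \<open>K\<close> makes the real-valued suprema genuine and nonnegative,
  so the infimum over subspaces is taken over a set bounded below. Nonnegativity is recorded because
  Landau estimates concern the absolute value of the width.\<close>

lemma kolmogorov_width_bounds:
  fixes K :: "'a::real_normed_vector set"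
  assumes K: "K \<noteq> {}" "bounded K" and B: "finite B" "card B \<le> n"
    and approx: "\<And>x. x \<in> K \<Longrightarrow> \<exists>y\<in>span B. norm (x - y) \<le> \<delta>"
  shows "0 \<le> kolmogorov_width n K" "kolmogorov_width n K \<le> \<delta>"
proof -
  let ?LL = "{L :: 'a set. subspace L \<and> (\<exists>B. finite B \<and> L = span B) \<and> dim L \<le> n}"
  let ?s = "\<lambda>L. SUP x\<in>K. INF y\<in>L. norm (x - y)"
  obtain x0 where x0: "x0 \<in> K" using K by blast
  obtain N where N: "\<And>x. x \<in> K \<Longrightarrow> norm x \<le> N"
    using K by (auto simp: bounded_iff)
  have s_nonneg: "0 \<le> ?s L" if "L \<in> ?LL" for L
  proof -
    have L: "0 \<in> L" using that by (auto intro: subspace_0)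
    have "bdd_above ((\<lambda>x. INF y\<in>L. norm (x - y)) ` K)"
      using INF_norm_diff(1)[OF L] N by (intro bdd_aboveI2[of _ _ N]) (auto intro: order_trans)
    hence "(INF y\<in>L. norm (x0 - y)) \<le> ?s L"
      by (rule cSUP_upper[OF x0])
    thus ?thesis
      using INF_norm_diff(2)[OF L, of x0] by linarith
  qed
  have L: "span B \<in> ?LL"
    using B dim_le_card'[of B] by auto
  show "0 \<le> kolmogorov_width n K"
    unfolding kolmogorov_width_def using L s_nonneg by (intro cINF_greatest) blast+
  have "kolmogorov_width n K \<le> ?s (span B)"
    unfolding kolmogorov_width_def
    by (rule cINF_lower[OF _ L]) (rule bdd_belowI2, rule s_nonneg)
  also have "\<dots> \<le> \<delta>"
    using K(1) approx by (intro cSUP_least) (auto intro: order_trans[OF INF_norm_diff(1)])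
  finally show "kolmogorov_width n K \<le> \<delta>" .
qed

text \<open>The e_\<theta> with \<theta> in [-r,r] span a space of dimension at most
  \<open>c * Suc r\<close>, and the discarded tail is Gaussian in \<open>r\<close>. Taking
  \<open>r\<close> about n / (c + 1) makes the dimension admissible and turns the error into a
  Gaussian in \<open>n\<close>.\<close>

lemma kolmogorov_width_K_set_bigo:
  assumes \<epsilon>: "0 < \<epsilon>" and ab: "a \<le> b" and S: "S \<in> locally_finite_sets"
    and count: "\<And>n. card (S \<inter> {- real n..real n}) \<le> c * Suc n"
  shows "\<exists>\<delta>>0. (\<lambda>n. kolmogorov_width n (K_set \<epsilon> S a b)) \<in> O(\<lambda>n. exp (- (\<delta> * (real n)\<^sup>2)))"
proof -
  define D where "D = sqrt (b - a) *
    ((1 + (b - a)) * (1 / sqrt (2 * pi * \<epsilon>) * exp ((a\<^sup>2 + b\<^sup>2) / (2 * \<epsilon>))) / sqrt (2 * pi * \<epsilon>))"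
  have "0 \<le> D" using \<epsilon> ab by (simp add: D_def)
  define \<beta> where "\<beta> = 1 / (4 * \<epsilon>)"
  have "0 < \<beta>" using \<epsilon> by (simp add: \<beta>_def)
  define W where "W = (\<Sum>\<^sub>\<infinity>\<theta>\<in>S. exp (- (\<beta> / 2 * \<theta>\<^sup>2)))"
  have "0 \<le> W" unfolding W_def by (rule infsum_nonneg) simp
  have summable: "(\<lambda>\<theta>. exp (- (\<gamma> * \<theta>\<^sup>2))) summable_on S" if "0 < \<gamma>" for \<gamma>
    using S count that by (rule summable_on_gauss_linear_count)
  let ?K = "K_set \<epsilon> S a b"
  have approx: "\<exists>y\<in>span (cut_gauss \<epsilon> a b ` F). norm (x - y) \<le> D * (\<Sum>\<^sub>\<infinity>\<theta>\<in>S - F. exp (- (\<beta> * \<theta>\<^sup>2)))"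
    if x: "x \<in> ?K" and F: "finite F" "F \<subseteq> S" for x F
  proof -
    obtain e where "norm (x - (\<Sum>\<theta>\<in>F. e \<theta> *\<^sub>R cut_gauss \<epsilon> a b \<theta>)) \<le>
        D * (\<Sum>\<^sub>\<infinity>\<theta>\<in>S - F. exp (- (\<beta> * \<theta>\<^sup>2)))"
      unfolding D_def \<beta>_def
      using A_Q_approx[OF \<epsilon> ab summable[OF \<open>0 < \<beta>\<close>, unfolded \<beta>_def] F x] by blast
    moreover have "(\<Sum>\<theta>\<in>F. e \<theta> *\<^sub>R cut_gauss \<epsilon> a b \<theta>) \<in> span (cut_gauss \<epsilon> a b ` F)"
      by (intro span_sum span_scale span_base) auto
    ultimately show ?thesis by blast
  qed
  have K_nonempty: "?K \<noteq> {}"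
  proof -
    have "Q a b 0 = 0"
      by (simp add: zero_l2_def Q.abs_eq l2_rel_refl square_integrable_zero)
    hence "0 \<in> range (Q a b)"
      by (metis rangeI)
    hence "A_Q \<epsilon> S a b 0 \<in> ?K"
      by (simp add: K_set_def)
    thus ?thesis by blast
  qed
  \<comment> \<open>For empty \<open>F\<close> the only approximant is 0, so the truncation error
    bounds the norm of \<open>x\<close> itself.\<close>
  have K_bounded: "bounded ?K"
    using approx[of _ "{}"] by (auto simp: bounded_iff)
  have width: "0 \<le> kolmogorov_width n ?K"
      "kolmogorov_width n ?K \<le> D * W * exp (- (\<beta> / 2 * (real r)\<^sup>2))" if r: "c * Suc r \<le> n" for n r :: nat
  proof -
    let ?F = "S \<inter> {- real r..real r}"
    have F: "finite ?F" "?F \<subseteq> S"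
      using finite_locally_finite_Int[OF S] by auto
    have card: "card (cut_gauss \<epsilon> a b ` ?F) \<le> n"
      using card_image_le[OF F(1)] count[of r] r by (meson order_trans)
    have "(\<Sum>\<^sub>\<infinity>\<theta>\<in>S - ?F. exp (- (\<beta> * \<theta>\<^sup>2))) \<le> exp (- (\<beta> / 2 * (real r)\<^sup>2)) * W"
      using infsum_gauss_tail_le[OF summable \<open>0 < \<beta>\<close>, of "real r"] \<open>0 < \<beta>\<close>
      by (simp add: W_def Diff_Int)
    from mult_left_mono[OF this \<open>0 \<le> D\<close>]
    have "\<exists>y\<in>span (cut_gauss \<epsilon> a b ` ?F). norm (x - y) \<le> D * W * exp (- (\<beta> / 2 * (real r)\<^sup>2))"
      if "x \<in> ?K" for x
      using approx[OF that F] by (force simp: mult_ac)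
    from kolmogorov_width_bounds[OF K_nonempty K_bounded _ card this] F(1)
    show "0 \<le> kolmogorov_width n ?K"
      "kolmogorov_width n ?K \<le> D * W * exp (- (\<beta> / 2 * (real r)\<^sup>2))" by auto
  qed
  \<comment> \<open>\<open>Suc c\<close> keeps the divisor positive when \<open>c\<close> is 0. The
    constant \<open>\<delta>\<close> is chosen so that
    \<open>\<delta> * (k\<^sup>2 * (2 * (real r)\<^sup>2 + 8))\<close> equals the available exponent
    plus the constant \<open>2 * \<beta>\<close>.\<close>
  define k where "k = real (Suc c)"
  define \<delta> where "\<delta> = \<beta> / (4 * k\<^sup>2)"
  have "0 < k" "0 < \<delta>" using \<open>0 < \<beta>\<close> by (auto simp: \<delta>_def k_def)
  have "norm (kolmogorov_width n ?K) \<le> D * W * exp (2 * \<beta>) * norm (exp (- (\<delta> * (real n)\<^sup>2)))"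
    if n: "n \<ge> Suc c" for n
  proof -
    \<comment> \<open>The shift by 1 absorbs the \<open>Suc r\<close> in the dimension bound;
      \<open>n \<ge> Suc c\<close> keeps the subtraction from truncating. Conversely
      \<open>n\<close> is at most \<open>Suc c * (r + 2)\<close>, so little of the exponent is
      lost.\<close>
    define r where "r = n div Suc c - 1"
    have "1 \<le> n div Suc c"
      using n by (simp add: Suc_le_eq div_greater_zero_iff)
    hence r: "Suc r = n div Suc c" by (simp add: r_def)
    have "c * Suc r \<le> n"
      unfolding r using div_times_less_eq_dividend[of n "Suc c"] by (simp add: algebra_simps)
    note w = width[OF this]
    have "n \<le> Suc c * (r + 2)"
      using dividend_less_div_times[of "Suc c" n] unfolding r[symmetric] by (simp add: algebra_simps)
    from of_nat_mono[OF this, where 'a = real] have "real n \<le> k * (real r + 2)"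
      by (simp only: k_def of_nat_mult of_nat_add of_nat_numeral)
    hence "(real n)\<^sup>2 \<le> (k * (real r + 2))\<^sup>2"
      by (intro power_mono) auto
    also have "\<dots> \<le> k\<^sup>2 * (2 * (real r)\<^sup>2 + 8)"
      using sum_squares_bound[of "real r" 2] unfolding power_mult_distrib
      by (intro mult_left_mono) (auto simp: power2_sum)
    finally have "\<delta> * (real n)\<^sup>2 \<le> \<delta> * (k\<^sup>2 * (2 * (real r)\<^sup>2 + 8))"
      using \<open>0 < \<delta>\<close> by simp
    also have "\<dots> = \<beta> / 2 * (real r)\<^sup>2 + 2 * \<beta>"
      using \<open>0 < k\<close> by (simp add: \<delta>_def field_simps)
    finally have "exp (- (\<beta> / 2 * (real r)\<^sup>2)) \<le> exp (2 * \<beta>) * exp (- (\<delta> * (real n)\<^sup>2))"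
      by (simp add: exp_add[symmetric])
    from mult_left_mono[OF this, of "D * W"] show ?thesis
      using w \<open>0 \<le> D\<close> \<open>0 \<le> W\<close> by (simp add: mult_ac)
  qed
  hence "(\<lambda>n. kolmogorov_width n ?K) \<in> O(\<lambda>n. exp (- (\<delta> * (real n)\<^sup>2)))"
    by (intro bigoI eventually_sequentiallyI) blast
  with \<open>0 < \<delta>\<close> show ?thesis by blast
qed

text \<open>A maximum is at least its first entry, so comparison with that entry is enough. A small
  \<open>C\<close> lets the faster decay absorb the quadratic term, and the shift by
  \<open>b\<close> costs only a constant factor.\<close>

lemma gauss_decay_bigo_max:
  assumes "0 < \<epsilon>" "0 < \<delta>"
  shows "\<exists>C>0. (\<lambda>n. exp (- (\<delta> * (real n)\<^sup>2))) \<in>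
    O(\<lambda>n. max (exp (- (C * real n - b)\<^sup>2 / \<epsilon>)) (exp (- (C * real n + a)\<^sup>2 / \<epsilon>)))"
proof -
  \<comment> \<open>Chosen so that \<open>2 * C\<^sup>2\<close> equals
    \<open>\<delta> * \<epsilon>\<close>; the 2 comes from bounding the square of a difference by
    twice the sum of the squares.\<close>
  define C where "C = sqrt (\<delta> * \<epsilon> / 2)"
  have "0 < C" and C2: "C\<^sup>2 = \<delta> * \<epsilon> / 2"
    using assms by (auto simp: C_def)
  have "norm (exp (- (\<delta> * (real n)\<^sup>2))) \<le> exp (2 * b\<^sup>2 / \<epsilon>) *
      norm (max (exp (- (C * real n - b)\<^sup>2 / \<epsilon>)) (exp (- (C * real n + a)\<^sup>2 / \<epsilon>)))" for n
  proof -
    have "(C * real n - b)\<^sup>2 \<le> 2 * C\<^sup>2 * (real n)\<^sup>2 + 2 * b\<^sup>2"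
      using zero_le_power2[of "C * real n + b"] by (simp add: power2_eq_square algebra_simps)
    also have "\<dots> = \<epsilon> * (\<delta> * (real n)\<^sup>2) + 2 * b\<^sup>2"
      by (simp add: C2)
    finally have "(C * real n - b)\<^sup>2 / \<epsilon> \<le> \<delta> * (real n)\<^sup>2 + 2 * b\<^sup>2 / \<epsilon>"
      using \<open>0 < \<epsilon>\<close> by (simp add: pos_divide_le_eq algebra_simps)
    hence "exp (- (\<delta> * (real n)\<^sup>2)) \<le> exp (2 * b\<^sup>2 / \<epsilon>) * exp (- (C * real n - b)\<^sup>2 / \<epsilon>)"
      by (simp add: exp_add[symmetric])
    also have "\<dots> \<le> exp (2 * b\<^sup>2 / \<epsilon>) *
        max (exp (- (C * real n - b)\<^sup>2 / \<epsilon>)) (exp (- (C * real n + a)\<^sup>2 / \<epsilon>))"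
      by (intro mult_left_mono) auto
    finally show ?thesis by (simp add: abs_of_nonneg le_max_iff_disj)
  qed
  with \<open>0 < C\<close> show ?thesis
    by (intro exI[of _ C] conjI bigoI always_eventually allI)
qed

theorem theorem3p1:
  fixes M :: "'w measure" and \<Theta> :: "'w \<Rightarrow> real set" and \<epsilon> a b :: real
  assumes "\<epsilon> > 0" and "a < b"
    and "point_process M \<Theta>" and "stationary M \<Theta>" and "ergodic M \<Theta>"
    and "(\<integral>\<^sup>+\<omega>. of_nat (card (\<Theta> \<omega> \<inter> {0..1})) \<partial>M) < \<infinity>"
  shows "AE \<omega> in M. \<exists>C>0.
    (\<lambda>n. kolmogorov_width n (K_set \<epsilon> (\<Theta> \<omega>) a b))
      \<in> O(\<lambda>n. max (exp (- (C * real n - b)\<^sup>2 / \<epsilon>)) (exp (- (C * real n + a)\<^sup>2 / \<epsilon>)))"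
  using AE_linear_count[OF assms(3,4,6)] AE_space
proof eventually_elim
  case (elim \<omega>)
  then obtain c where count: "\<And>n. card (\<Theta> \<omega> \<inter> {- real n..real n}) \<le> c * Suc n"
    by blast
  have "\<Theta> \<omega> \<in> locally_finite_sets"
    using assms(3) elim by (auto simp: point_process_def space_config_space[symmetric] dest: measurable_space)
  then obtain \<delta> where "0 < \<delta>"
    and \<delta>: "(\<lambda>n. kolmogorov_width n (K_set \<epsilon> (\<Theta> \<omega>) a b)) \<in> O(\<lambda>n. exp (- (\<delta> * (real n)\<^sup>2)))"
    using kolmogorov_width_K_set_bigo[OF assms(1) less_imp_le[OF assms(2)] _ count] by blast
  show ?case
    \<comment> \<open>The density constant \<open>c\<close> belongs to the realization, so
      \<open>\<delta>\<close> and with it \<open>C\<close> may depend on \<omega>.\<close>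
    using gauss_decay_bigo_max[OF assms(1) \<open>0 < \<delta>\<close>] landau_o.big_trans[OF \<delta>] by blast
qed

end
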